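(* Let the plant $\dot x=f(x,u)$ with steady-state map $h:\mathbb{R}^p\to\mathbb{R}^n$ satisfy the Plant Assumption. Let $\Phi:\mathbb{R}^n\times\mathbb{R}^p\to\mathbb{R}$ be continuously differentiable with locally Lipschitz gradient, and let $L>0$ be such that $$\left\| H(u)^T\left(\nabla\Phi(x',u)^T-\nabla\Phi(x,u)^T\right)\right\|\le L\|x'-x\|\qquad\text{for all } x,x'\in\mathbb{R}^n,\ u\in\mathbb{R}^p .$$ Let $W:\mathbb{R}^n\times\mathbb{R}^p\to\mathbb{R}$ be a Lyapunov function for the plant with constants $\alpha,\beta,\gamma,\zeta>0$ as defined in the context. Assume that $\tilde\Phi(u):=\Phi(h(u),u)$ has compact level sets, is $\mu$-strongly convex ($\mu>0$) and twice continuously differentiable, and let $Q(u):=\epsilon\,(\nabla^2\tilde\Phi(u))^{-1}$ with $\epsilon>0$, assumed locally Lipschitz in $u$. If $$\epsilon<\frac{\gamma\mu}{\zeta L},$$ then the closed-loop system $$\dot x=f(x,u),\qquad \dot u=-Q(u)H(u)^T\,\nabla\Phi(x,u)^T$$ is asymptotically stable and converges to the unique global minimizer of $\min_{x,u}\{\Phi(x,u)\mid x=h(u)\}$; that is, this minimizer $(x^\star,u^\star)$ is an asymptotically stable equilibrium and all trajectories converge to it.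
   Context: Notation: $\nabla$ denotes the Jacobian (a row vector for scalar functions), so $\nabla\Phi(x,u)^T\in\mathbb{R}^{n+p}$ is the gradient of $\Phi$ with respect to $(x,u)$. $\|\cdot\|$ is the Euclidean norm or the induced matrix norm. $H(u)^T:=\begin{bmatrix}\nabla h(u)^T & I_p\end{bmatrix}\in\mathbb{R}^{p\times(n+p)}$. A function $V$ has compact level sets if $\{u: V(u)\le c\}$ is compact for every $c\in\mathbb{R}$. $\tilde\Phi$ is $\mu$-strongly convex if $\tilde\Phi(v)-\tilde\Phi(u)-\nabla\tilde\Phi(u)(v-u)\ge\frac{\mu}{2}\|v-u\|^2$ for all $u,v$. Plant Assumption: $f:\mathbb{R}^n\times\mathbb{R}^p\to\mathbb{R}^n$ is continuously differentiable, $\ell_x$-Lipschitz in $x$ and $\ell_u$-Lipschitz in $u$. The map $h:\mathbb{R}^p\to\mathbb{R}^n$ is continuously differentiable, $\ell$-Lipschitz, and satisfies $f(h(u),u)=0$ for all $u\in\mathbb{R}^p$. There exist $\tau,K>0$ such that for every $x_0\in\mathbb{R}^n$ and every constant $\hat u\in\mathbb{R}^p$ the solution of $\dot x=f(x,\hat u)$, $x(0)=x_0$, satisfies $\|x(t)-h(\hat u)\|\le K\|x_0-h(\hat u)\|e^{-\tau t}$ for all $t\ge 0$. Lyapunov function $W$ with constants $\alpha,\beta,\gamma,\zeta>0$: $W$ is differentiable and for all $(x,u)$: $\alpha\|x-h(u)\|^2\le W(x,u)\le\beta\|x-h(u)\|^2$, $\ \nabla_xW(x,u)f(x,u)\le-\gamma\|x-h(u)\|^2$,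 $\ \|\nabla_uW(x,u)\|\le\zeta\|x-h(u)\|$. Asymptotic stability is in the sense of Lyapunov. *)

theory Defs
  imports "HOL-Analysis.Analysis"
begin

definition continuously_differentiable ::
  "('a::real_normed_vector \<Rightarrow> 'b::real_normed_vector) \<Rightarrow> bool" where
  "continuously_differentiable F \<longleftrightarrow>
     (\<exists>F'. (\<forall>z. (F has_derivative blinfun_apply (F' z)) (at z)) \<and> continuous_on UNIV F')"

definition gradient :: "('a::real_inner \<Rightarrow> real) \<Rightarrow> 'a \<Rightarrow> 'a" where
  "gradient F z = (THE D. GDERIV F z :> D)"

definition twice_continuously_differentiable :: "('a::real_inner \<Rightarrow> real) \<Rightarrow> bool" where
  "twice_continuously_differentiable F \<longleftrightarrow>
     continuously_differentiable F \<and> continuously_differentiable (gradient F)"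

definition hessian :: "(real^'p \<Rightarrow> real) \<Rightarrow> real^'p \<Rightarrow> real^'p^'p" where
  "hessian F u = jacobian (gradient F) (at u)"

text \<open>The constant real parameter is a dummy: it only adapts the time-dependent library notion.\<close>

definition locally_lipschitz :: "('a::metric_space \<Rightarrow> 'b::metric_space) \<Rightarrow> bool" where
  "locally_lipschitz g \<longleftrightarrow> local_lipschitz (UNIV :: real set) UNIV (\<lambda>_. g)"

definition compact_level_sets :: "('a::topological_space \<Rightarrow> real) \<Rightarrow> bool" where
  "compact_level_sets V \<longleftrightarrow> (\<forall>c. compact {u. V u \<le> c})"

definition strongly_convex :: "real \<Rightarrow> ('a::real_inner \<Rightarrow> real) \<Rightarrow> bool" where
  "strongly_convex \<mu> F \<longleftrightarrow>
     (\<forall>u v. F v - F u - gradient F u \<bullet> (v - u) \<ge> \<mu> / 2 * (norm (v - u))\<^sup>2)"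

definition solution_on ::
  "('a::real_normed_vector \<Rightarrow> 'a) \<Rightarrow> real set \<Rightarrow> (real \<Rightarrow> 'a) \<Rightarrow> bool" where
  "solution_on F J z \<longleftrightarrow> (\<forall>t\<in>J. (z has_vector_derivative F (z t)) (at t within J))"

definition lyapunov_stable :: "('a::real_normed_vector \<Rightarrow> 'a) \<Rightarrow> 'a \<Rightarrow> bool" where
  "lyapunov_stable F zs \<longleftrightarrow>
     (\<forall>e>0. \<exists>d>0. \<forall>z. solution_on F {0..} z \<and> norm (z 0 - zs) < d \<longrightarrow>
        (\<forall>t\<ge>0. norm (z t - zs) < e))"

definition asymptotically_stable :: "('a::real_normed_vector \<Rightarrow> 'a) \<Rightarrow> 'a \<Rightarrow> bool" where
  "asymptotically_stable F zs \<longleftrightarrow>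
     F zs = 0 \<and> lyapunov_stable F zs \<and>
     (\<exists>r>0. \<forall>z. solution_on F {0..} z \<and> norm (z 0 - zs) < r \<longrightarrow> (z \<longlongrightarrow> zs) at_top)"

text \<open>Every initial value problem has a solution on the whole half line, and every solution
  given on a bounded interval extends to one; so no trajectory escapes in finite time.
  Uniqueness of solutions is not claimed: the closed-loop vector field below is continuous, but it
  contains the Jacobian of \<open>h\<close>, which need not be locally Lipschitz.\<close>

definition forward_complete :: "('a::real_normed_vector \<Rightarrow> 'a) \<Rightarrow> bool" where
  "forward_complete F \<longleftrightarrow>
     (\<forall>z0. \<exists>z. solution_on F {0..} z \<and> z 0 = z0) \<and>
     (\<forall>b>0. \<forall>y. solution_on F {0..<b} y \<longrightarrow>
        (\<exists>z. solution_on F {0..} z \<and> (\<forall>t\<in>{0..<b}. z t = y t)))"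

text \<open>The space of pairs \<open>(x, u)\<close> plays the role of the (n+p)-dimensional Euclidean space;
  the norm of the product type is the Euclidean one.\<close>

definition plant_assumption ::
  "((real^'n) \<times> (real^'p) \<Rightarrow> real^'n) \<Rightarrow> (real^'p \<Rightarrow> real^'n) \<Rightarrow> real \<Rightarrow> real \<Rightarrow> real \<Rightarrow> bool" where
  "plant_assumption f h lx lu l \<longleftrightarrow>
     continuously_differentiable f \<and>
     (\<forall>u. lx-lipschitz_on UNIV (\<lambda>x. f (x, u))) \<and>
     (\<forall>x. lu-lipschitz_on UNIV (\<lambda>u. f (x, u))) \<and>
     continuously_differentiable h \<and>
     l-lipschitz_on UNIV h \<and>
     (\<forall>u. f (h u, u) = 0) \<and>
     (\<exists>\<tau> K. \<tau> > 0 \<and> K > 0 \<and>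
        (\<forall>x0 u x. solution_on (\<lambda>y. f (y, u)) {0..} x \<and> x 0 = x0 \<longrightarrow>
           (\<forall>t\<ge>0. norm (x t - h u) \<le> K * norm (x0 - h u) * exp (- \<tau> * t))))"

definition lyapunov_function ::
  "((real^'n) \<times> (real^'p) \<Rightarrow> real^'n) \<Rightarrow> (real^'p \<Rightarrow> real^'n) \<Rightarrow>
   ((real^'n) \<times> (real^'p) \<Rightarrow> real) \<Rightarrow> real \<Rightarrow> real \<Rightarrow> real \<Rightarrow> real \<Rightarrow> bool" where
  "lyapunov_function f h W \<alpha> \<beta> \<gamma> \<zeta> \<longleftrightarrow>
     \<alpha> > 0 \<and> \<beta> > 0 \<and> \<gamma> > 0 \<and> \<zeta> > 0 \<and>
     (\<forall>z. W differentiable (at z)) \<and>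
     (\<forall>x u. \<alpha> * (norm (x - h u))\<^sup>2 \<le> W (x, u) \<and> W (x, u) \<le> \<beta> * (norm (x - h u))\<^sup>2) \<and>
     (\<forall>x u. gradient (\<lambda>y. W (y, u)) x \<bullet> f (x, u) \<le> - \<gamma> * (norm (x - h u))\<^sup>2) \<and>
     (\<forall>x u. norm (gradient (\<lambda>v. W (x, v)) u) \<le> \<zeta> * norm (x - h u))"

text \<open>The block matrix consisting of the transposed Jacobian of \<open>h\<close> and the identity, acting on
  a pair.\<close>

definition H_transpose :: "(real^'p \<Rightarrow> real^'n) \<Rightarrow> real^'p \<Rightarrow> (real^'n) \<times> (real^'p) \<Rightarrow> real^'p" where
  "H_transpose h u w = transpose (jacobian h (at u)) *v fst w + mat 1 *v snd w"

definition reduced_cost ::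
  "((real^'n) \<times> (real^'p) \<Rightarrow> real) \<Rightarrow> (real^'p \<Rightarrow> real^'n) \<Rightarrow> real^'p \<Rightarrow> real" where
  "reduced_cost \<Phi> h u = \<Phi> (h u, u)"

definition newton_gain ::
  "real \<Rightarrow> ((real^'n) \<times> (real^'p) \<Rightarrow> real) \<Rightarrow> (real^'p \<Rightarrow> real^'n) \<Rightarrow> real^'p \<Rightarrow> real^'p^'p" where
  "newton_gain \<epsilon> \<Phi> h u = \<epsilon> *\<^sub>R matrix_inv (hessian (reduced_cost \<Phi> h) u)"

definition closed_loop ::
  "((real^'n) \<times> (real^'p) \<Rightarrow> real^'n) \<Rightarrow> (real^'p \<Rightarrow> real^'n) \<Rightarrow> ((real^'n) \<times> (real^'p) \<Rightarrow> real) \<Rightarrow>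
   (real^'p \<Rightarrow> real^'p^'p) \<Rightarrow> (real^'n) \<times> (real^'p) \<Rightarrow> (real^'n) \<times> (real^'p)" where
  "closed_loop f h \<Phi> Q = (\<lambda>(x, u). (f (x, u), - (Q u *v H_transpose h u (gradient \<Phi> (x, u)))))"

end

theory Submission
  imports Defs "HOL-Complex_Analysis.Great_Picard"
begin

text \<open>
  The proof exhibits a strict Lyapunov function for the interconnection. Write \<open>\<phi>\<close> for the
  reduced cost, \<open>w = \<parallel>x - h u\<parallel>\<close> for the distance of the plant to its steady state and
  \<open>y = \<parallel>u'\<parallel>\<close> for the speed of the input, and put \<open>V(x, u) = \<phi>(u) + (L / \<zeta>) W(x, u)\<close>.
  The controller uses the measured gradient, which differs from \<open>\<nabla>\<phi>(u)\<close> by at most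
  \<open>L w\<close>. As the Hessian of \<open>\<phi>\<close> is bounded below by \<open>\<mu>\<close>, the Newton step decreases
  \<open>\<phi>\<close> at the rate \<open>(\<mu> / \<epsilon>) y\<^sup>2 - L w y\<close> at least (lemma \<open>newton_step_decrease\<close>),
  while \<open>W\<close> decreases at the rate \<open>\<gamma> w\<^sup>2 - \<zeta> w y\<close> at least (lemma
  \<open>lyapunov_function_rate\<close>). Altogether \<open>V\<close> decreases at least at the rate
  \<open>(\<mu> / \<epsilon>) y\<^sup>2 - 2 L w y + (L \<gamma> / \<zeta>) w\<^sup>2\<close>, and this quadratic form in \<open>(y, w)\<close> is positive
  definite precisely when \<open>\<epsilon> < \<gamma> \<mu> / (\<zeta> L)\<close> (lemma \<open>quadratic_form_positive\<close>). It vanishes only at \<open>x = h u\<close> with \<open>\<nabla>\<phi>(u) = 0\<close>, that is, at the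
  minimizer. Strong convexity also makes \<open>V\<close> minus its minimum dominate a multiple of the squared
  distance to the minimizer.

  From such a \<open>V\<close>, stability and convergence of all trajectories follow in general (theorem
  \<open>global_asymptotic_stability\<close>). Existence of trajectories is the other half of the proof. The
  closed-loop field contains the Jacobian of \<open>h\<close>, which is only continuous, so the
  Picard--Lindeloef theorem does not apply. Instead Peano's theorem for bounded continuous fields
  is proved (theorem \<open>peano_bounded\<close>), and the bounded sublevel sets of \<open>V\<close> extend it to
  the closed loop (theorem \<open>forward_complete_lyapunov\<close>).
\<close>

section \<open>Existence of solutions for bounded continuous vector fields\<close>

lemma solution_on_if_integral_equation:
  fixes F :: "'a::banach \<Rightarrow> 'a"
  assumes F: "continuous_on UNIV F"
    and z: "continuous_on {0..} z"
    and eq: "\<And>t. 0 \<le> t \<Longrightarrow> z t = z0 + integral {0..t} (\<lambda>s. F (z s))"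
  shows "solution_on F {0..} z"
  unfolding solution_on_def
proof
  fix t :: real assume "t \<in> {0..}"
  then have t: "0 \<le> t" by simp
  have "continuous_on {0..t+1} (\<lambda>s. F (z s))"
    by (rule continuous_on_compose2[OF F continuous_on_subset[OF z]]) auto
  then have "((\<lambda>r. z0 + integral {0..r} (\<lambda>s. F (z s))) has_vector_derivative F (z t))
      (at t within {0..t+1})"
    using integral_has_vector_derivative[of 0 "t+1" "\<lambda>s. F (z s)" t] t
    by (auto intro!: derivative_eq_intros)
  then have "(z has_vector_derivative F (z t)) (at t within {0..t+1})"
    by (rule has_vector_derivative_transform[rotated 2]) (use t eq in auto)
  moreover have "at t within {0..t+1} = at t within {0..}"
    by (rule at_within_nhd[of _ "{..<t+1}"]) auto
  ultimately show "(z has_vector_derivative F (z t)) (at t within {0..})"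
    by simp
qed

text \<open>Solutions can be glued without inspecting one-sided derivatives at the seam: the fundamental
  theorem of calculus tolerates finitely many exceptional points, and the integral equation then
  gives back the derivative there.\<close>

lemma solution_on_if_derivative_off_finite:
  fixes F :: "'a::banach \<Rightarrow> 'a"
  assumes F: "continuous_on UNIV F"
    and z: "continuous_on {0..} z"
    and "finite S"
    and deriv: "\<And>t. 0 < t \<Longrightarrow> t \<notin> S \<Longrightarrow> (z has_vector_derivative F (z t)) (at t)"
  shows "solution_on F {0..} z"
proof (rule solution_on_if_integral_equation[OF F z])
  fix t :: real assume "0 \<le> t"
  have "((\<lambda>s. F (z s)) has_integral z t - z 0) {0..t}"
    by (rule fundamental_theorem_of_calculus_interior_strong[OF \<open>finite S\<close> \<open>0 \<le> t\<close>])
      (use deriv continuous_on_subset[OF z] in auto)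
  then show "z t = z 0 + integral {0..t} (\<lambda>s. F (z s))"
    by (simp add: integral_unique)
qed

text \<open>The Picard operator of \<open>F\<close> with the argument delayed by \<open>d\<close>. Since the integral over
  an empty interval is \<open>0\<close>, the value at every negative time is \<open>z0\<close>, so this also
  supplies the history that the delay looks up.\<close>

definition delayed_integral ::
  "('a::real_normed_vector \<Rightarrow> 'a) \<Rightarrow> real \<Rightarrow> 'a \<Rightarrow> (real \<Rightarrow> 'a) \<Rightarrow> real \<Rightarrow> 'a" where
  "delayed_integral F d z0 w t = z0 + integral {0..t} (\<lambda>s. F (w (s - d)))"

lemma delayed_integral_nonpos: "t \<le> 0 \<Longrightarrow> delayed_integral F d z0 w t = z0"
  by (cases "t = 0") (auto simp: delayed_integral_def)

text \<open>The constant does not depend on \<open>d\<close> or \<open>w\<close>; this is what makes the approximate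
  solutions equicontinuous.\<close>

lemma delayed_integral_lipschitz:
  fixes F :: "'a::banach \<Rightarrow> 'a"
  assumes F: "continuous_on UNIV F" and w: "continuous_on UNIV w"
    and bound: "\<And>x. norm (F x) \<le> M"
  shows "norm (delayed_integral F d z0 w t - delayed_integral F d z0 w s) \<le> M * \<bar>t - s\<bar>"
proof -
  let ?G = "delayed_integral F d z0 w" and ?g = "\<lambda>s. F (w (s - d))"
  have M: "0 \<le> M" by (rule order_trans[OF norm_ge_zero bound])
  have cont: "continuous_on A ?g" for A
    by (rule continuous_on_compose2[OF F continuous_on_compose2[OF w]])
      (auto intro!: continuous_intros)
  have pos: "norm (?G t - ?G s) \<le> M * (t - s)" if "0 \<le> s" "s \<le> t" for s t
  proof -
    have "?G t - ?G s = integral {s..t} ?g"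
      using Henstock_Kurzweil_Integration.integral_combine[OF that integrable_continuous_real[OF cont]]
      by (simp add: delayed_integral_def algebra_simps)
    then show ?thesis
      using integral_bound[OF \<open>s \<le> t\<close> cont] bound by simp
  qed
  have max: "?G r = ?G (max 0 r)" for r
    by (cases "r \<le> 0") (auto simp: delayed_integral_nonpos max_def)
  have ord: "norm (?G t - ?G s) \<le> M * \<bar>t - s\<bar>" if "s \<le> t" for s t
  proof -
    have "norm (?G (max 0 t) - ?G (max 0 s)) \<le> M * (max 0 t - max 0 s)"
      by (rule pos) (use that in auto)
    also have "\<dots> \<le> M * \<bar>t - s\<bar>" by (rule mult_left_mono[OF _ M]) (use that in auto)
    finally show ?thesis by (simp flip: max)
  qed
  show ?thesis
    using ord[of s t] ord[of t s] by (cases "s \<le> t") (auto simp: norm_minus_commute abs_minus_commute)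
qed

text \<open>With a delay the Picard iteration becomes stationary instead of merely converging: the
  iterate number \<open>k + 1\<close> on \<open>(-\<infinity>, k d]\<close> only looks at iterate \<open>k\<close> on
  \<open>(-\<infinity>, (k - 1) d]\<close>. So for a merely continuous \<open>F\<close>,
  \<open>k \<ge> T / d\<close> iterations solve the delayed equation up to time \<open>T\<close>.\<close>

lemma delayed_solution_exists:
  fixes F :: "'a::banach \<Rightarrow> 'a"
  assumes F: "continuous_on UNIV F" and bound: "\<And>x. norm (F x) \<le> M" and d: "0 < d"
  obtains w where "\<And>s t. norm (w t - w s) \<le> M * \<bar>t - s\<bar>" "w 0 = z0"
    "\<And>t. t \<le> T \<Longrightarrow> w t = z0 + integral {0..t} (\<lambda>s. F (w (s - d)))"
proof -
  let ?G = "delayed_integral F d z0"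
  define w where "w k = (?G ^^ k) (\<lambda>_. z0)" for k
  have wS: "w (Suc k) = ?G (w k)" for k by (simp add: w_def)
  have M: "0 \<le> M" by (rule order_trans[OF norm_ge_zero bound])
  have lip: "norm (w k t - w k s) \<le> M * \<bar>t - s\<bar>" for k s t
  proof (induction k arbitrary: s t)
    case 0 then show ?case using M by (simp add: w_def)
  next
    case (Suc k)
    have "M-lipschitz_on UNIV (w k)"
      using Suc M by (auto intro!: lipschitz_onI simp: dist_norm)
    then show ?case
      unfolding wS by (intro delayed_integral_lipschitz F bound lipschitz_on_continuous_on)
  qed
  have stable: "w (Suc k) t = w k t" if "t \<le> real k * d" for k t
    using that
  proof (induction k arbitrary: t)
    case 0 then show ?case by (simp add: w_def delayed_integral_nonpos)
  next
    case (Suc k)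
    have "integral {0..t} (\<lambda>s. F (w (Suc k) (s - d))) = integral {0..t} (\<lambda>s. F (w k (s - d)))"
    proof (rule integral_cong)
      fix s assume "s \<in> {0..t}"
      then have "s - d \<le> real k * d" using Suc.prems by (auto simp: algebra_simps)
      then show "F (w (Suc k) (s - d)) = F (w k (s - d))" using Suc.IH by simp
    qed
    then show ?case by (simp only: wS[of "Suc k"] wS[of k] delayed_integral_def)
  qed
  obtain k where k: "T \<le> real k * d"
    using reals_Archimedean3[OF d] less_imp_le by blast
  show ?thesis
  proof (rule that[of "w k"])
    show "norm (w k t - w k s) \<le> M * \<bar>t - s\<bar>" for s t by (rule lip)
    show "w k 0 = z0" by (cases k) (simp add: w_def, simp add: wS delayed_integral_nonpos)
    show "w k t = z0 + integral {0..t} (\<lambda>s. F (w k (s - d)))" if "t \<le> T" for t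
      using stable[of t k] that k by (simp add: wS delayed_integral_def)
  qed
qed

text \<open>A diagonal subsequence converges at all rational times, and equicontinuity carries the
  convergence over to all real times.\<close>

lemma lipschitz_convergent_subsequence:
  fixes w :: "nat \<Rightarrow> real \<Rightarrow> 'a::{heine_borel, banach}"
  assumes lip: "\<And>n s t. norm (w n t - w n s) \<le> M * \<bar>t - s\<bar>" and w0: "\<And>n. w n 0 = z0"
  obtains k z where "strict_mono (k::nat \<Rightarrow> nat)" "\<And>t. (\<lambda>n. w (k n) t) \<longlonglongrightarrow> z t"
    "\<And>s t. norm (z t - z s) \<le> M * \<bar>t - s\<bar>"
proof -
  have M: "0 \<le> M" using order_trans[OF norm_ge_zero lip[of 0 1 0]] by simp
  \<comment> \<open>the diagonal argument needs a bound uniform in time, hence the weight\<close>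
  have bd: "norm ((1 / (1 + \<bar>t\<bar>)) *\<^sub>R w n t) \<le> norm z0 + M" for n t
  proof -
    have "norm (w n t) \<le> norm z0 + M * \<bar>t\<bar>"
      using lip[of n t 0] norm_triangle_sub[of "w n t" z0] by (simp add: w0)
    also have "\<dots> \<le> (norm z0 + M) * (1 + \<bar>t\<bar>)"
      using M by (simp add: algebra_simps)
    finally show ?thesis by (simp add: divide_simps)
  qed
  obtain k where k: "strict_mono (k::nat \<Rightarrow> nat)"
    and lim: "\<And>t. t \<in> \<rat> \<Longrightarrow> \<exists>l. (\<lambda>n. (1 / (1 + \<bar>t\<bar>)) *\<^sub>R w (k n) t) \<longlonglongrightarrow> l"
    using function_convergent_subsequence[OF countable_rat,
        of "\<lambda>n t. (1 / (1 + \<bar>t\<bar>)) *\<^sub>R w n t", OF bd] by blast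
  have rat: "convergent (\<lambda>n. w (k n) q)" if q: "q \<in> \<rat>" for q
  proof -
    obtain l where "(\<lambda>n. (1 / (1 + \<bar>q\<bar>)) *\<^sub>R w (k n) q) \<longlonglongrightarrow> l" using lim[OF q] by blast
    then have "(\<lambda>n. (1 + \<bar>q\<bar>) *\<^sub>R ((1 / (1 + \<bar>q\<bar>)) *\<^sub>R w (k n) q)) \<longlonglongrightarrow> (1 + \<bar>q\<bar>) *\<^sub>R l"
      by (rule tendsto_scaleR[OF tendsto_const])
    moreover have "1 + \<bar>q\<bar> \<noteq> 0" by linarith
    ultimately have "(\<lambda>n. w (k n) q) \<longlonglongrightarrow> (1 + \<bar>q\<bar>) *\<^sub>R l"
      by simp
    then show ?thesis by (rule convergentI)
  qed
  have "Cauchy (\<lambda>n. w (k n) t)" for t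
  proof (rule metric_CauchyI)
    fix e :: real assume e: "0 < e"
    define r where "r = e / (3 * (M + 1))"
    have r: "0 < r" using e M by (simp add: r_def)
    obtain q where q: "q \<in> \<rat>" "t < q" "q < t + r"
      using Rats_dense_in_real[of t "t + r"] r by auto
    have "M * \<bar>t - q\<bar> \<le> (M + 1) * r"
      using q M r by (intro mult_mono) auto
    also have "\<dots> = e / 3" using M by (simp add: r_def field_simps)
    finally have Mr: "M * \<bar>t - q\<bar> \<le> e / 3" .
    obtain N where N: "\<And>m n. m \<ge> N \<Longrightarrow> n \<ge> N \<Longrightarrow> dist (w (k m) q) (w (k n) q) < e / 3"
      using metric_CauchyD[OF convergent_Cauchy[OF rat[OF q(1)]], of "e/3"] e by auto
    have "dist (w (k m) t) (w (k n) t) < e" if "m \<ge> N" "n \<ge> N" for m n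
    proof -
      have "dist (w (k m) t) (w (k n) t)
          \<le> dist (w (k m) t) (w (k m) q) + dist (w (k m) q) (w (k n) q) + dist (w (k n) q) (w (k n) t)"
        using dist_triangle[of "w (k m) t" "w (k n) t" "w (k m) q"]
          dist_triangle[of "w (k m) q" "w (k n) t" "w (k n) q"] by linarith
      moreover have "dist (w (k m) t) (w (k m) q) \<le> e / 3"
        using lip[of "k m" t q] Mr by (simp add: dist_norm)
      moreover have "dist (w (k n) q) (w (k n) t) \<le> e / 3"
        using lip[of "k n" q t] Mr by (simp add: dist_norm abs_minus_commute)
      ultimately show ?thesis using N[OF that] by linarith
    qed
    then show "\<exists>N. \<forall>m\<ge>N. \<forall>n\<ge>N. dist (w (k m) t) (w (k n) t) < e" by blast
  qed
  then have "\<exists>l. (\<lambda>n. w (k n) t) \<longlonglongrightarrow> l" for t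
    by (simp add: Cauchy_convergent_iff convergent_def)
  then obtain z where z: "\<And>t. (\<lambda>n. w (k n) t) \<longlonglongrightarrow> z t" by metis
  moreover have "norm (z t - z s) \<le> M * \<bar>t - s\<bar>" for s t
    by (rule tendsto_upperbound[OF tendsto_norm[OF tendsto_diff[OF z z]]]) (auto simp: lip)
  ultimately show ?thesis using that k by blast
qed

text \<open>Peano's theorem by Tonelli's construction: let the delay \<open>1 / (n + 1)\<close> tend to \<open>0\<close>
  while the time up to which the delayed equation holds tends to infinity. Pointwise convergence
  suffices to pass to the limit, because \<open>F\<close> is bounded and dominated convergence applies.
  In contrast to the usual compactness argument on a bounded interval, this yields a solution on
  the whole half line at once.\<close>

theorem peano_bounded:
  fixes F :: "'a::euclidean_space \<Rightarrow> 'a"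
  assumes F: "continuous_on UNIV F" and bound: "\<And>x. norm (F x) \<le> M"
  obtains z where "solution_on F {0..} z" "z 0 = z0"
proof -
  have "\<exists>w. (\<forall>s t. norm (w t - w s) \<le> M * \<bar>t - s\<bar>) \<and> w 0 = z0 \<and>
      (\<forall>t\<le>real n. w t = z0 + integral {0..t} (\<lambda>s. F (w (s - 1 / real (Suc n)))))" for n
  proof -
    have "0 < 1 / real (Suc n)" by simp
    from delayed_solution_exists[OF F bound this, of z0 "real n"] show ?thesis by blast
  qed
  then obtain w where lip: "\<And>n s t. norm (w n t - w n s) \<le> M * \<bar>t - s\<bar>" and w0: "\<And>n. w n 0 = z0"
    and weq: "\<And>n t. t \<le> real n \<Longrightarrow>
        w n t = z0 + integral {0..t} (\<lambda>s. F (w n (s - 1 / real (Suc n))))"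
    by metis
  obtain k z where k: "strict_mono k" and lim: "\<And>t. (\<lambda>n. w (k n) t) \<longlonglongrightarrow> z t"
    and zlip: "\<And>s t. norm (z t - z s) \<le> M * \<bar>t - s\<bar>"
    using lipschitz_convergent_subsequence[where w=w, OF lip w0] by blast
  have M: "0 \<le> M" by (rule order_trans[OF norm_ge_zero bound])
  define d where "d n = 1 / real (Suc (k n))" for n
  have d: "d \<longlonglongrightarrow> 0"
    unfolding d_def
    using LIMSEQ_subseq_LIMSEQ[OF LIMSEQ_Suc[OF lim_1_over_n] k] by (simp add: o_def)
  have delayed: "(\<lambda>n. w (k n) (s - d n)) \<longlonglongrightarrow> z s" for s
  proof -
    have "(\<lambda>n. w (k n) (s - d n) - w (k n) s) \<longlonglongrightarrow> 0"
    proof (rule tendsto_0_le[where K=M])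
      show "(\<lambda>n. d n) \<longlonglongrightarrow> 0" by (rule d)
      show "\<forall>\<^sub>F n in sequentially. norm (w (k n) (s - d n) - w (k n) s) \<le> norm (d n) * M"
        using lip[of _ "s - d _" s] by (intro always_eventually allI) (simp add: mult.commute)
    qed
    from tendsto_add[OF this lim[of s]] show ?thesis by simp
  qed
  have wcont: "continuous_on A (w n)" for A n
    by (rule lipschitz_on_continuous_on[where L=M]) (auto intro!: lipschitz_onI simp: dist_norm lip M)
  have zeq: "z t = z0 + integral {0..t} (\<lambda>s. F (z s))" if "0 \<le> t" for t
  proof -
    have "(\<lambda>n. integral {0..t} (\<lambda>s. F (w (k n) (s - d n)))) \<longlonglongrightarrow> integral {0..t} (\<lambda>s. F (z s))"
    proof (rule dominated_convergence)
      show "(\<lambda>s. F (w (k n) (s - d n))) integrable_on {0..t}" for n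
        by (intro integrable_continuous_real continuous_on_compose2[OF F]
            continuous_on_compose2[OF wcont[of UNIV]]) (auto intro!: continuous_intros)
      show "(\<lambda>n. F (w (k n) (s - d n))) \<longlonglongrightarrow> F (z s)" for s
        by (rule continuous_on_tendsto_compose[OF F delayed]) auto
      show "(\<lambda>_. M) integrable_on {0..t}" by (rule integrable_const_ivl)
    qed (rule bound)
    then have "(\<lambda>n. z0 + integral {0..t} (\<lambda>s. F (w (k n) (s - d n))))
        \<longlonglongrightarrow> z0 + integral {0..t} (\<lambda>s. F (z s))"
      by (rule tendsto_add[OF tendsto_const])
    moreover have "\<forall>\<^sub>F n in sequentially.
        z0 + integral {0..t} (\<lambda>s. F (w (k n) (s - d n))) = w (k n) t"
    proof -
      obtain N :: nat where N: "t \<le> real N" using real_arch_simple by blast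
      show ?thesis
        using eventually_ge_at_top[of N]
      proof eventually_elim
        case (elim n)
        then have "t \<le> real (k n)"
          using N seq_suble[OF k, of n] by linarith
        then show ?case using weq by (simp add: d_def)
      qed
    qed
    ultimately have "(\<lambda>n. w (k n) t) \<longlonglongrightarrow> z0 + integral {0..t} (\<lambda>s. F (z s))"
      by (rule Lim_transform_eventually)
    with lim show ?thesis by (rule LIMSEQ_unique)
  qed
  have "continuous_on {0..} z"
    by (rule lipschitz_on_continuous_on[where L=M]) (auto intro!: lipschitz_onI simp: dist_norm zlip M)
  then have "solution_on F {0..} z"
    using zeq by (rule solution_on_if_integral_equation[OF F])
  moreover have "z 0 = z0" using zeq[of 0] by simp
  ultimately show ?thesis by (rule that)
qed

section \<open>Lyapunov functions for continuous vector fields\<close>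

lemma lyapunov_decrease:
  fixes F :: "'a::real_normed_vector \<Rightarrow> 'a" and V :: "'a \<Rightarrow> real"
  assumes V: "\<And>z. (V has_derivative V' z) (at z)"
    and sol: "solution_on F J z" and ab: "a \<le> b" "{a..b} \<subseteq> J"
    and dec: "\<And>t. t \<in> {a<..<b} \<Longrightarrow> V' (z t) (F (z t)) \<le> - m"
  shows "V (z b) + m * (b - a) \<le> V (z a)"
proof -
  have deriv: "(z has_vector_derivative F (z t)) (at t within {a..b})" if "t \<in> {a..b}" for t
    using sol ab(2) that unfolding solution_on_def
    by (blast intro: has_vector_derivative_within_subset)
  have Vderiv: "((\<lambda>t. V (z t)) has_vector_derivative V' (z t) (F (z t))) (at t within {a..b})"
    if "t \<in> {a..b}" for t
    using vector_derivative_diff_chain_within[OF deriv[OF that] has_derivative_at_withinI[OF V]]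
    by (simp add: o_def)
  have "V (z b) + m * (b - a) \<le> V (z a) + m * (a - a)"
  proof (rule DERIV_nonpos_imp_decreasing_open[OF ab(1)])
    fix t assume t: "a < t" "t < b"
    then have "((\<lambda>t. V (z t)) has_vector_derivative V' (z t) (F (z t))) (at t)"
      using Vderiv[of t] at_within_Icc_at[of a t b] by simp
    then have "((\<lambda>t. V (z t) + m * (t - a)) has_real_derivative V' (z t) (F (z t)) + m) (at t)"
      unfolding has_real_derivative_iff_has_vector_derivative[symmetric]
      by (auto intro!: derivative_eq_intros)
    then show "\<exists>y. ((\<lambda>t. V (z t) + m * (t - a)) has_real_derivative y) (at t) \<and> y \<le> 0"
      using dec[of t] t by fastforce
  next
    have "continuous_on {a..b} (\<lambda>t. V (z t))"
      using Vderiv by (rule continuous_on_vector_derivative)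
    then show "continuous_on {a..b} (\<lambda>t. V (z t) + m * (t - a))"
      by (intro continuous_intros)
  qed
  then show ?thesis by simp
qed

lemma lyapunov_nonincreasing:
  fixes F :: "'a::real_normed_vector \<Rightarrow> 'a" and V :: "'a \<Rightarrow> real"
  assumes V: "\<And>z. (V has_derivative V' z) (at z)"
    and dec: "\<And>z. V' z (F z) \<le> 0"
    and "solution_on F J z" "a \<le> b" "{a..b} \<subseteq> J"
  shows "V (z b) \<le> V (z a)"
  using lyapunov_decrease[OF V assms(3-5), where m=0] dec by simp

lemma continuous_bounded_on_ball:
  fixes F :: "'a::{real_normed_vector, heine_borel} \<Rightarrow> 'b::real_normed_vector"
  assumes "continuous_on UNIV F"
  obtains M where "0 \<le> M" "\<And>z. norm z \<le> R \<Longrightarrow> norm (F z) \<le> M"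
proof -
  have "bounded (F ` cball 0 R)"
    using assms by (intro compact_imp_bounded compact_continuous_image) (auto intro: continuous_on_subset)
  then obtain M where "0 < M" "\<forall>y \<in> F ` cball 0 R. norm y \<le> M"
    unfolding bounded_pos by blast
  then show ?thesis using that[of M] by auto
qed

text \<open>Multiplying \<open>F\<close> by a cutoff with values in \<open>[0, 1]\<close> makes it bounded and only
  rescales the derivative of \<open>V\<close> along it, so \<open>V\<close> still decreases along the solutions
  of the truncated field. These therefore remain in the sublevel set of their initial value, where
  the cutoff is \<open>1\<close>, and solve the original equation.\<close>

lemma global_solution_exists:
  fixes F :: "'a::euclidean_space \<Rightarrow> 'a" and V :: "'a \<Rightarrow> real"
  assumes F: "continuous_on UNIV F"
    and V: "\<And>z. (V has_derivative V' z) (at z)"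
    and dec: "\<And>z. V' z (F z) \<le> 0"
    and bounded: "\<And>c. bounded {z. V z \<le> c}"
  obtains z where "solution_on F {0..} z" "z 0 = z0"
proof -
  obtain R where R: "\<And>z. V z \<le> V z0 \<Longrightarrow> norm z \<le> R"
    using bounded[of "V z0"] unfolding bounded_iff by blast
  define cut where "cut z = max 0 (min 1 (R + 1 - norm z))" for z :: 'a
  let ?F = "\<lambda>z. cut z *\<^sub>R F z"
  have cut: "0 \<le> cut z" "cut z \<le> 1" for z by (auto simp: cut_def)
  have cont: "continuous_on UNIV ?F"
    unfolding cut_def by (intro continuous_intros F)
  obtain M where M0: "0 \<le> M" and M: "\<And>z. norm z \<le> R + 1 \<Longrightarrow> norm (F z) \<le> M"
    using continuous_bounded_on_ball[OF F] by blast
  have "norm (?F z) \<le> M" for z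
  proof (cases "norm z \<le> R + 1")
    case True
    have "cut z * norm (F z) \<le> 1 * norm (F z)" by (intro mult_right_mono cut) simp
    then show ?thesis using M[OF True] cut[of z] by simp
  next
    case False then show ?thesis using M0 by (simp add: cut_def)
  qed
  with cont obtain z where z: "solution_on ?F {0..} z" "z 0 = z0"
    using peano_bounded[of ?F M z0] by metis
  have "V' x (?F x) \<le> 0" for x
  proof -
    have "V' x (?F x) = cut x * V' x (F x)"
      using linear_cmul[OF has_derivative_linear[OF V]] by simp
    then show ?thesis using cut dec by (simp add: mult_nonneg_nonpos)
  qed
  then have "V (z t) \<le> V z0" if "0 \<le> t" for t
    using lyapunov_nonincreasing[OF V _ z(1) that] z(2) that by auto
  then have "cut (z t) = 1" if "0 \<le> t" for t
    using R that by (fastforce simp: cut_def)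
  then have "solution_on F {0..} z"
    using z(1) by (simp add: solution_on_def)
  then show ?thesis using z(2) by (rule that)
qed

lemma solution_on_interior_derivative:
  assumes "solution_on F J z" "t \<in> interior J"
  shows "(z has_vector_derivative F (z t)) (at t)"
  using assms interior_subset[of J] at_within_interior[of t J] by (metis solution_on_def subsetD)

text \<open>A bounded solution has bounded speed, hence is Lipschitz and has a limit at the open end
  \<open>b\<close>; a global solution from that limit continues it.\<close>

lemma solution_extends:
  fixes F :: "'a::euclidean_space \<Rightarrow> 'a"
  assumes F: "continuous_on UNIV F" and b: "0 < b"
    and y: "solution_on F {0..<b} y" and bounded: "bounded (y ` {0..<b})"
    and ex: "\<And>z0. \<exists>z. solution_on F {0..} z \<and> z 0 = z0"
  shows "\<exists>z. solution_on F {0..} z \<and> (\<forall>t\<in>{0..<b}. z t = y t)"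
proof -
  obtain R where R: "\<And>t. t \<in> {0..<b} \<Longrightarrow> norm (y t) \<le> R"
    using bounded unfolding bounded_iff by blast
  obtain M where M0: "0 \<le> M" and M: "\<And>z. norm z \<le> R \<Longrightarrow> norm (F z) \<le> M"
    using continuous_bounded_on_ball[OF F] by blast
  have "M-lipschitz_on {0..<b} y"
  proof (rule bounded_derivative_imp_lipschitz)
    show "(y has_derivative (\<lambda>s. s *\<^sub>R F (y t))) (at t within {0..<b})" if "t \<in> {0..<b}" for t
      using y that by (auto simp: solution_on_def has_vector_derivative_def)
    show "onorm (\<lambda>s. s *\<^sub>R F (y t)) \<le> M" if "t \<in> {0..<b}" for t
      by (rule onorm_bound[OF M0])
        (use mult_right_mono[OF M[OF R[OF that]] abs_ge_zero] in \<open>simp add: mult.commute\<close>)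
  qed (use M0 in auto)
  then obtain g where g: "M-lipschitz_on (closure {0..<b}) g" and gy: "\<And>t. t \<in> {0..<b} \<Longrightarrow> g t = y t"
    using lipschitz_extend_closure by blast
  have gcont: "continuous_on {0..b} g"
    using lipschitz_on_continuous_on[OF g] b by simp
  obtain z2 where z2: "solution_on F {0..} z2" "z2 0 = g b" using ex by blast
  have z2cont: "continuous_on {0..} z2"
    using z2(1)
    by (intro continuous_on_vector_derivative[where f'="\<lambda>t. F (z2 t)"]) (simp add: solution_on_def)
  define z where "z t = (if t \<le> b then g t else z2 (t - b))" for t
  have zcont: "continuous_on {0..} z"
  proof -
    have "continuous_on ({0..b} \<union> {b..}) z"
      unfolding z_def
      by (rule continuous_on_If)
        (use z2(2) in \<open>auto intro!: gcont continuous_on_compose2[OF z2cont] continuous_intros\<close>)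
    moreover have "{0..b} \<union> {b..} = {0..}" using b by auto
    ultimately show ?thesis by simp
  qed
  have "solution_on F {0..} z"
  proof (rule solution_on_if_derivative_off_finite[OF F zcont, of "{b}"])
    fix t assume t: "0 < t" "t \<notin> {b}"
    show "(z has_vector_derivative F (z t)) (at t)"
    proof (cases "t < b")
      case True
      have "(y has_vector_derivative F (y t)) (at t)"
        by (rule solution_on_interior_derivative[OF y]) (use t True in simp)
      then have "(z has_vector_derivative F (y t)) (at t)"
        by (rule has_vector_derivative_transform_within_open[of _ _ _ "{0<..<b}"])
          (use t True gy in \<open>auto simp: z_def\<close>)
      then show ?thesis using t True gy by (simp add: z_def)
    next
      case False
      with t have tb: "b < t" by simp
      have "(z2 has_vector_derivative F (z2 (t - b))) (at (t - b))"
        by (rule solution_on_interior_derivative[OF z2(1)]) (use tb in simp)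
      moreover have "((\<lambda>t. t - b) has_vector_derivative 1) (at t)"
        by (auto intro!: derivative_eq_intros)
      ultimately have "((\<lambda>t. z2 (t - b)) has_vector_derivative F (z2 (t - b))) (at t)"
        using vector_diff_chain_at[of "\<lambda>t. t - b" 1 t z2] by (simp add: o_def)
      then have "(z has_vector_derivative F (z2 (t - b))) (at t)"
        by (rule has_vector_derivative_transform_within_open[of _ _ _ "{b<..}"])
          (use tb in \<open>auto simp: z_def\<close>)
      then show ?thesis using tb by (simp add: z_def)
    qed
  qed simp
  moreover have "\<forall>t\<in>{0..<b}. z t = y t" using gy by (auto simp: z_def)
  ultimately show ?thesis by blast
qed

theorem forward_complete_lyapunov:
  fixes F :: "'a::euclidean_space \<Rightarrow> 'a" and V :: "'a \<Rightarrow> real"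
  assumes F: "continuous_on UNIV F"
    and V: "\<And>z. (V has_derivative V' z) (at z)"
    and dec: "\<And>z. V' z (F z) \<le> 0"
    and bounded: "\<And>c. bounded {z. V z \<le> c}"
  shows "forward_complete F"
proof -
  have ex: "\<exists>z. solution_on F {0..} z \<and> z 0 = z0" for z0
    using global_solution_exists[OF F V dec bounded] by metis
  have "\<exists>z. solution_on F {0..} z \<and> (\<forall>t\<in>{0..<b}. z t = y t)"
    if b: "0 < b" and y: "solution_on F {0..<b} y" for b y
  proof (rule solution_extends[OF F b y _ ex])
    have "V (y t) \<le> V (y 0)" if "t \<in> {0..<b}" for t
      using lyapunov_nonincreasing[OF V dec y, of 0 t] that by (auto simp: subset_iff)
    then show "bounded (y ` {0..<b})"
      by (intro bounded_subset[OF bounded[of "V (y 0)"]]) auto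
  qed
  with ex show ?thesis by (simp add: forward_complete_def)
qed

lemma coercive_bounded_sublevel:
  fixes V :: "'a::real_normed_vector \<Rightarrow> real"
  assumes C: "0 < C" and coercive: "\<And>z. (norm (z - zs))\<^sup>2 \<le> C * (V z - V zs)"
  shows "bounded {z. V z \<le> c}"
proof (rule bounded_subset[OF bounded_cball])
  show "{z. V z \<le> c} \<subseteq> cball zs (sqrt (C * (c - V zs)))"
  proof
    fix z assume "z \<in> {z. V z \<le> c}"
    then have "C * (V z - V zs) \<le> C * (c - V zs)" using C by simp
    then have "(norm (z - zs))\<^sup>2 \<le> C * (c - V zs)"
      using coercive[of z] by linarith
    then show "z \<in> cball zs (sqrt (C * (c - V zs)))"
      by (simp add: dist_norm norm_minus_commute real_le_rsqrt)
  qed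
qed

text \<open>Stability reduces attractivity to reaching every ball around the equilibrium once. If a
  trajectory stayed at distance \<open>d\<close> from the equilibrium, then it would remain in a compact
  set without the equilibrium, where \<open>D\<close> has a positive minimum; \<open>V\<close> would decrease
  at least linearly and fall below its minimum. So every trajectory enters every ball around the
  equilibrium, and by stability, stated here for an arbitrary initial time, it does not leave
  a slightly larger one afterwards. The derivative \<open>V'\<close> may be discontinuous; therefore
  the continuous bound \<open>D\<close> is a separate function.\<close>

theorem global_asymptotic_stability:
  fixes F :: "'a::euclidean_space \<Rightarrow> 'a" and V D :: "'a \<Rightarrow> real"
  assumes V: "\<And>z. (V has_derivative V' z) (at z)"
    and D: "continuous_on UNIV D" "\<And>z. z \<noteq> zs \<Longrightarrow> 0 < D z" "D zs \<ge> 0"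
    and dec: "\<And>z. V' z (F z) \<le> - D z"
    and C: "0 < C" and coercive: "\<And>z. (norm (z - zs))\<^sup>2 \<le> C * (V z - V zs)"
    and equilibrium: "F zs = 0"
  shows "asymptotically_stable F zs"
    and "\<And>z. solution_on F {0..} z \<Longrightarrow> (z \<longlongrightarrow> zs) at_top"
proof -
  have Dnn: "0 \<le> D z" for z using D(2,3) less_imp_le by (cases "z = zs") auto
  have min: "V zs \<le> V z" for z
  proof -
    have "0 \<le> C * (V z - V zs)" by (rule order_trans[OF zero_le_power2 coercive])
    then show ?thesis using C by (simp add: zero_le_mult_iff)
  qed
  have noninc: "V (z b) \<le> V (z a)" if "solution_on F {0..} z" "0 \<le> a" "a \<le> b" for z a b
  proof (rule lyapunov_nonincreasing[OF V _ that(1,3)])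
    show "V' x (F x) \<le> 0" for x using dec[of x] Dnn[of x] by linarith
  qed (use that in auto)
  have stable: "\<exists>d>0. \<forall>z T. solution_on F {0..} z \<and> 0 \<le> T \<and> norm (z T - zs) < d \<longrightarrow>
      (\<forall>t\<ge>T. norm (z t - zs) < e)" if e: "0 < e" for e
  proof -
    define \<eta> where "\<eta> = e\<^sup>2 / C"
    have "0 < \<eta>" using e C by (simp add: \<eta>_def)
    moreover have "isCont V zs" using V has_derivative_continuous by blast
    ultimately obtain d where d: "0 < d" "\<And>x. norm (x - zs) < d \<Longrightarrow> \<bar>V x - V zs\<bar> < \<eta>"
      by (metis continuous_at_eps_delta dist_norm real_norm_def)
    have "norm (z t - zs) < e"
      if z: "solution_on F {0..} z" "0 \<le> T" "norm (z T - zs) < d" "T \<le> t" for z t T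
    proof (rule power_less_imp_less_base[of _ 2])
      have "V (z t) - V zs < \<eta>" using noninc[OF z(1,2,4)] d(2)[OF z(3)] by linarith
      then have "C * (V (z t) - V zs) < e\<^sup>2"
        using C by (simp add: \<eta>_def field_simps)
      then show "(norm (z t - zs))\<^sup>2 < e\<^sup>2"
        using coercive[of "z t"] by linarith
    qed (use e in simp)
    then show ?thesis using d(1) by blast
  qed
  have lyap: "lyapunov_stable F zs"
    unfolding lyapunov_stable_def using stable by (metis order_refl)
  show conv: "(z \<longlongrightarrow> zs) at_top" if z: "solution_on F {0..} z" for z
  proof (rule tendstoI)
    fix e :: real assume "0 < e"
    with stable obtain d where d: "0 < d"
      "\<And>T t. 0 \<le> T \<Longrightarrow> norm (z T - zs) < d \<Longrightarrow> T \<le> t \<Longrightarrow> norm (z t - zs) < e"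
      using z by metis
    have "\<exists>T\<ge>0. norm (z T - zs) < d"
    proof (rule ccontr)
      assume "\<not> ?thesis"
      then have far: "\<And>t. 0 \<le> t \<Longrightarrow> d \<le> norm (z t - zs)" by force
      define K where "K = {x. V x \<le> V (z 0)} - ball zs d"
      have inK: "z t \<in> K" if "0 \<le> t" for t
        using noninc[OF z order_refl that] far[OF that]
        by (auto simp: K_def dist_norm norm_minus_commute)
      have Vcont: "continuous_on UNIV V"
        using V has_derivative_continuous continuous_at_imp_continuous_on by blast
      have "bounded {x. V x \<le> V (z 0)}"
        by (rule coercive_bounded_sublevel[OF C coercive])
      then have "compact K"
        unfolding K_def compact_eq_bounded_closed
        using continuous_on_closed_Collect_le[OF Vcont continuous_on_const] 
        by (auto intro: bounded_diff)
      then obtain x where x: "x \<in> K" "\<And>y. y \<in> K \<Longrightarrow> D x \<le> D y"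
        using continuous_attains_inf[OF \<open>compact K\<close> _ continuous_on_subset[OF D(1)]] inK[of 0]
        by blast
      have "x \<noteq> zs" using x(1) d(1) by (auto simp: K_def)
      then have m: "0 < D x" by (rule D(2))
      have dec': "V (z t) + D x * t \<le> V (z 0)" if "0 \<le> t" for t
      proof -
        have "V' (z s) (F (z s)) \<le> - D x" if "s \<in> {0<..<t}" for s
          using dec[of "z s"] x(2)[OF inK[of s]] that by auto
        then show ?thesis
          using lyapunov_decrease[OF V z that, of "D x"] by simp
      qed
      \<comment> \<open>by this time the linear decrease would exceed the available gap by \<open>1\<close>\<close>
      define t where "t = (V (z 0) - V zs + 1) / D x"
      have "0 \<le> t" using min[of "z 0"] m by (simp add: t_def)
      from dec'[OF this] min[of "z t"] m show False by (simp add: t_def)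
    qed
    then obtain T where T: "0 \<le> T" "norm (z T - zs) < d" by blast
    show "\<forall>\<^sub>F t in at_top. dist (z t) zs < e"
      using eventually_ge_at_top[of T] by eventually_elim (simp add: dist_norm d(2)[OF T])
  qed
  show "asymptotically_stable F zs"
    unfolding asymptotically_stable_def using equilibrium lyap conv zero_less_one by blast
qed

section \<open>Gradients and continuity of the closed loop\<close>

lemma gradient_eq:
  assumes "(F has_derivative (\<lambda>v. v \<bullet> d)) (at z)"
  shows "gradient F z = d"
  unfolding gradient_def gderiv_def
proof (rule the_equality)
  show "(F has_derivative (\<lambda>v. v \<bullet> d)) (at z)" by (rule assms)
  fix d' assume "(F has_derivative (\<lambda>v. v \<bullet> d')) (at z)"
  then have "(\<lambda>v. v \<bullet> d') = (\<lambda>v. v \<bullet> d)" using assms by (rule has_derivative_unique)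
  then show "d' = d" by (metis inner_commute vector_eq_rdot)
qed

lemma has_derivative_eq_gradient:
  fixes F :: "'a::euclidean_space \<Rightarrow> real"
  assumes "(F has_derivative F') (at z)"
  shows "F' v = v \<bullet> gradient F z"
proof -
  have "F' = (\<lambda>v. v \<bullet> adjoint F' 1)"
    using adjoint_works[OF has_derivative_linear[OF assms]] by (auto simp: fun_eq_iff)
  moreover from this have "gradient F z = adjoint F' 1"
    using gradient_eq[of F "adjoint F' 1" z] assms by simp
  ultimately show ?thesis by metis
qed

lemma has_derivative_gradient:
  fixes F :: "'a::euclidean_space \<Rightarrow> real"
  assumes "F differentiable (at z)"
  shows "(F has_derivative (\<lambda>v. v \<bullet> gradient F z)) (at z)"
proof -
  obtain F' where F': "(F has_derivative F') (at z)"
    using assms unfolding differentiable_def by blast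
  moreover have "F' = (\<lambda>v. v \<bullet> gradient F z)"
    using has_derivative_eq_gradient[OF F'] by blast
  ultimately show ?thesis by simp
qed

lemma continuously_differentiable_imp_differentiable:
  "continuously_differentiable F \<Longrightarrow> F differentiable (at z)"
  unfolding continuously_differentiable_def differentiable_def by blast

lemma continuously_differentiable_imp_continuous:
  "continuously_differentiable F \<Longrightarrow> continuous_on A F"
  using continuously_differentiable_imp_differentiable differentiable_imp_continuous_within
    continuous_at_imp_continuous_on by blast

lemma locally_lipschitz_imp_continuous: "locally_lipschitz g \<Longrightarrow> continuous_on UNIV g"
  unfolding locally_lipschitz_def by (erule local_lipschitz_continuous_on) simp

lemma continuous_on_jacobian:
  fixes h :: "real^'p \<Rightarrow> real^'n"
  assumes "continuously_differentiable h"
  shows "continuous_on A (\<lambda>u. jacobian h (at u))"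
proof -
  obtain h' where h': "\<And>u. (h has_derivative blinfun_apply (h' u)) (at u)"
    and cont: "continuous_on UNIV h'"
    using assms unfolding continuously_differentiable_def by blast
  have "jacobian h (at u) = (\<chi> i j. blinfun_apply (h' u) (axis j 1) $ i)" for u
    using frechet_derivative_at[OF h'[of u]] by (simp add: jacobian_def matrix_def)
  then show ?thesis
    by (simp, intro continuous_intros continuous_on_subset[OF cont]) auto
qed

lemma continuous_on_matrix_vector_mult:
  fixes A :: "'a::topological_space \<Rightarrow> real^'n^'m"
  assumes "continuous_on S A" "continuous_on S x"
  shows "continuous_on S (\<lambda>z. A z *v x z)"
  unfolding matrix_vector_mult_def by (intro continuous_intros assms)

lemma H_transpose_diff: "H_transpose h u (w - w') = H_transpose h u w - H_transpose h u w'"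
  by (simp add: H_transpose_def matrix_vector_mult_diff_distrib)

text \<open>The operator is the adjoint of the derivative of \<open>u \<mapsto> (h u, u)\<close>, which is the
  reason why it turns gradients of \<open>\<Phi>\<close> into gradients of the reduced cost.\<close>

lemma inner_H_transpose: "v \<bullet> H_transpose h u w = (jacobian h (at u) *v v, v) \<bullet> w"
  using dot_lmul_matrix[of "fst w" "jacobian h (at u)" v]
  by (cases w) (simp add: H_transpose_def inner_add_right transpose_matrix_vector inner_commute)

lemma continuous_on_closed_loop:
  fixes f :: "(real^'n) \<times> (real^'p) \<Rightarrow> real^'n"
  assumes "continuous_on UNIV f" "continuously_differentiable h"
    "continuous_on UNIV (gradient \<Phi>)" "continuous_on UNIV Q"
  shows "continuous_on UNIV (closed_loop f h \<Phi> Q)"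
proof -
  have Q: "continuous_on UNIV (\<lambda>z::(real^'n) \<times> (real^'p). Q (snd z))"
    by (rule continuous_on_compose2[OF assms(4)]) (auto intro!: continuous_intros)
  have J: "continuous_on UNIV (\<lambda>z::(real^'n) \<times> (real^'p). jacobian h (at (snd z)))"
    by (rule continuous_on_compose2[OF continuous_on_jacobian[OF assms(2)]])
      (auto intro!: continuous_intros)
  have T: "continuous_on UNIV (\<lambda>z. transpose (jacobian h (at (snd z))) *v fst (gradient \<Phi> z))"
    unfolding transpose_def matrix_vector_mult_def by (intro continuous_intros J assms)
  have "continuous_on UNIV (\<lambda>z. (f z, - (Q (snd z) *v H_transpose h (snd z) (gradient \<Phi> z))))"
    unfolding H_transpose_def matrix_vector_mul_lid
    by (intro continuous_on_Pair continuous_on_minus continuous_on_matrix_vector_mult[OF Q]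
        continuous_on_add T continuous_on_snd assms)
  then show ?thesis by (simp add: closed_loop_def case_prod_beta')
qed

lemma gradient_reduced_cost:
  fixes \<Phi> :: "(real^'n) \<times> (real^'p) \<Rightarrow> real"
  assumes "\<Phi> differentiable (at (h u, u))" "h differentiable (at u)"
  shows "gradient (reduced_cost \<Phi> h) u = H_transpose h u (gradient \<Phi> (h u, u))"
proof -
  have "((\<lambda>u. (h u, u)) has_derivative (\<lambda>v. (jacobian h (at u) *v v, v))) (at u)"
    using assms(2) unfolding jacobian_works by (intro has_derivative_Pair has_derivative_ident)
  from has_derivative_compose[OF this has_derivative_gradient[OF assms(1)]]
  have "(reduced_cost \<Phi> h has_derivative
      (\<lambda>v. v \<bullet> H_transpose h u (gradient \<Phi> (h u, u)))) (at u)"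
    by (simp add: reduced_cost_def[abs_def] inner_H_transpose)
  then show ?thesis by (rule gradient_eq)
qed

lemma partial_gradients:
  fixes W :: "'a::euclidean_space \<times> 'b::euclidean_space \<Rightarrow> real"
  assumes W: "(W has_derivative W') (at (x, u))"
  shows "W' (a, b) = a \<bullet> gradient (\<lambda>y. W (y, u)) x + b \<bullet> gradient (\<lambda>v. W (x, v)) u"
proof -
  have x: "((\<lambda>y. W (y, u)) has_derivative (\<lambda>a. W' (a, 0))) (at x)"
    using W by (intro has_derivative_compose[where f="\<lambda>y. (y, u)" and g=W])
      (auto intro!: derivative_eq_intros)
  have u: "((\<lambda>v. W (x, v)) has_derivative (\<lambda>b. W' (0, b))) (at u)"
    using W by (intro has_derivative_compose[where f="\<lambda>v. (x, v)" and g=W])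
      (auto intro!: derivative_eq_intros)
  have "W' (a, b) = W' (a, 0) + W' (0, b)"
    using linear_add[OF has_derivative_linear[OF W], of "(a, 0)" "(0, b)"] by simp
  then show ?thesis
    using has_derivative_eq_gradient[OF x, of a] has_derivative_eq_gradient[OF u, of b] by simp
qed

section \<open>Strong convexity\<close>

lemma strongly_convex_gradient_monotone:
  assumes "strongly_convex \<mu> F"
  shows "\<mu> * (norm (v - u))\<^sup>2 \<le> (gradient F v - gradient F u) \<bullet> (v - u)"
proof -
  have "\<mu> / 2 * (norm (v - u))\<^sup>2 \<le> F v - F u - gradient F u \<bullet> (v - u)"
    "\<mu> / 2 * (norm (v - u))\<^sup>2 \<le> F u - F v - gradient F v \<bullet> (u - v)"
    using assms norm_minus_commute[of u v] unfolding strongly_convex_def by metis+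
  then show ?thesis by (simp add: inner_diff_left inner_diff_right)
qed

text \<open>Divide the monotonicity inequality for \<open>u\<close> and \<open>u + t v\<close> by \<open>t\<^sup>2\<close> and let
  \<open>t\<close> decrease to \<open>0\<close>. For the gradient of a strongly convex function this is the lower
  bound on the Hessian.\<close>

lemma strongly_monotone_derivative:
  fixes g :: "'a::real_inner \<Rightarrow> 'a"
  assumes mono: "\<And>u v. \<mu> * (norm (v - u))\<^sup>2 \<le> (g v - g u) \<bullet> (v - u)"
    and g: "(g has_derivative g') (at u)"
  shows "\<mu> * (norm v)\<^sup>2 \<le> g' v \<bullet> v"
proof -
  have "((\<lambda>t. u + t *\<^sub>R v) has_derivative (\<lambda>t. t *\<^sub>R v)) (at (0::real))"
    by (auto intro!: derivative_eq_intros)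
  then have "((\<lambda>t. g (u + t *\<^sub>R v)) has_derivative (\<lambda>t. g' (t *\<^sub>R v))) (at (0::real))"
    by (rule has_derivative_compose) (use g in simp)
  then have "((\<lambda>t. g (u + t *\<^sub>R v) \<bullet> v) has_derivative (\<lambda>t. g' (t *\<^sub>R v) \<bullet> v)) (at (0::real))"
    by (intro has_derivative_inner_left)
  then have "((\<lambda>t. g (u + t *\<^sub>R v) \<bullet> v) has_real_derivative g' v \<bullet> v) (at 0)"
    by (rule has_derivative_imp_has_field_derivative)
      (simp add: linear_cmul[OF has_derivative_linear[OF g]] mult.commute)
  then have "((\<lambda>t. (g (u + t *\<^sub>R v) \<bullet> v - g u \<bullet> v) / t) \<longlongrightarrow> g' v \<bullet> v) (at 0)"
    by (simp add: has_field_derivative_iff)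
  then have lim: "((\<lambda>t. (g (u + t *\<^sub>R v) \<bullet> v - g u \<bullet> v) / t) \<longlongrightarrow> g' v \<bullet> v) (at_right 0)"
    by (rule tendsto_mono[rotated]) (simp add: at_le)
  have "\<mu> * (norm v)\<^sup>2 \<le> (g (u + t *\<^sub>R v) \<bullet> v - g u \<bullet> v) / t" if "0 < t" for t
  proof -
    have "t * (t * (\<mu> * (norm v)\<^sup>2)) \<le> t * (g (u + t *\<^sub>R v) \<bullet> v - g u \<bullet> v)"
      using mono[of "u + t *\<^sub>R v" u]
      by (simp add: inner_diff_left power2_eq_square algebra_simps)
    then show ?thesis using that by (simp add: pos_le_divide_eq mult.commute)
  qed
  then have "\<forall>\<^sub>F t in at_right 0. \<mu> * (norm v)\<^sup>2 \<le> (g (u + t *\<^sub>R v) \<bullet> v - g u \<bullet> v) / t"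
    by (auto simp: eventually_at_filter)
  then show ?thesis by (rule tendsto_lowerbound[OF lim]) simp
qed

lemma matrix_inv_right_if_pos_def:
  fixes A :: "real^'p^'p"
  assumes "0 < \<mu>" and pos: "\<And>v. \<mu> * (norm v)\<^sup>2 \<le> (A *v v) \<bullet> v"
  shows "A *v (matrix_inv A *v q) = q"
proof -
  have "v = 0" if "A *v v = 0" for v
  proof -
    have "\<mu> * (norm v)\<^sup>2 \<le> 0" using pos[of v] that by simp
    then have "(norm v)\<^sup>2 \<le> 0" using \<open>0 < \<mu>\<close> by (simp add: mult_le_0_iff)
    then show ?thesis by simp
  qed
  then have "invertible A"
    unfolding invertible_left_inverse matrix_left_invertible_ker by blast
  then have "A ** matrix_inv A = mat 1"
    unfolding invertible_def matrix_inv_def by (rule someI2_ex) blast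
  then show ?thesis by (simp add: matrix_vector_mul_assoc)
qed

text \<open>Completing the square. The hypothesis says that the discriminant is negative; in the
  application it is exactly the bound on the gain.\<close>

lemma quadratic_form_positive:
  fixes \<kappa> L \<rho> y w :: real
  assumes "0 < \<kappa>" "L\<^sup>2 < \<kappa> * \<rho>" "y \<noteq> 0 \<or> w \<noteq> 0"
  shows "0 < \<kappa> * y\<^sup>2 - 2 * L * w * y + \<rho> * w\<^sup>2"
proof -
  have "\<kappa> * (\<kappa> * y\<^sup>2 - 2 * L * w * y + \<rho> * w\<^sup>2) = (\<kappa> * y - L * w)\<^sup>2 + (\<kappa> * \<rho> - L\<^sup>2) * w\<^sup>2"
    by (simp add: power2_eq_square algebra_simps)
  also have "0 < \<dots>"
  proof (cases "w = 0")
    case True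
    then show ?thesis using assms by simp
  next
    case False
    then show ?thesis using assms(2) by (intro add_nonneg_pos) simp_all
  qed
  finally show ?thesis using assms(1) by (simp add: zero_less_mult_iff)
qed

lemma strongly_convex_minimizer:
  fixes F :: "'a::euclidean_space \<Rightarrow> real"
  assumes level: "compact_level_sets F" and "0 < \<mu>" and convex: "strongly_convex \<mu> F"
    and diff: "\<And>u. F differentiable (at u)"
  obtains us where "gradient F us = 0" "\<And>u. F us + \<mu> / 2 * (norm (u - us))\<^sup>2 \<le> F u"
proof -
  have "continuous_on {u. F u \<le> F 0} F"
    using diff differentiable_imp_continuous_within continuous_at_imp_continuous_on by blast
  then obtain us where us: "F us \<le> F 0" "\<And>u. F u \<le> F 0 \<Longrightarrow> F us \<le> F u"
    using continuous_attains_inf[of "{u. F u \<le> F 0}" F] level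
    unfolding compact_level_sets_def by auto
  then have min: "F us \<le> F u" for u by (meson linear order_trans)
  have "(\<lambda>v. v \<bullet> gradient F us) = (\<lambda>v. 0)"
    by (rule differential_zero_maxmin[of us UNIV F]) (auto intro: has_derivative_gradient diff min)
  then have grad: "gradient F us = 0"
    by (metis inner_eq_zero_iff)
  have "F us + \<mu> / 2 * (norm (u - us))\<^sup>2 \<le> F u" for u
    using convex grad unfolding strongly_convex_def by (metis diff_zero inner_zero_left le_diff_eq add.commute)
  with grad show ?thesis by (rule that)
qed

section \<open>Stability of the closed loop\<close>

text \<open>Here \<open>q\<close> is the measured gradient and \<open>q - e\<close> the true one. Bounding the decrease
  by the length of the step \<open>b\<close> instead of that of the gradient is essential: with
  \<open>q = A v\<close> and \<open>b = - \<epsilon> v\<close>, the lower bound on \<open>A\<close> gives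
  \<open>b \<bullet> q \<le> - (\<mu> / \<epsilon>) \<parallel>b\<parallel>\<^sup>2\<close>; a bound in terms of \<open>\<parallel>q\<parallel>\<close> would involve the
  norm of the Hessian \<open>A\<close>, which may be unbounded as a function of \<open>u\<close>.\<close>

lemma newton_step_decrease:
  fixes A :: "real^'p^'p" and q e :: "real^'p"
  assumes "0 < \<mu>" "0 < \<epsilon>" and pos: "\<And>v. \<mu> * (norm v)\<^sup>2 \<le> (A *v v) \<bullet> v"
    and e: "norm e \<le> r" and b: "b = - (\<epsilon> *\<^sub>R (matrix_inv A *v q))"
  shows "b \<bullet> (q - e) \<le> - (\<mu> / \<epsilon>) * (norm b)\<^sup>2 + r * norm b"
proof -
  define v where "v = matrix_inv A *v q"
  have q: "A *v v = q" unfolding v_def by (rule matrix_inv_right_if_pos_def[OF \<open>0 < \<mu>\<close> pos])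
  have "b \<bullet> q = - \<epsilon> * ((A *v v) \<bullet> v)"
    by (simp add: b q inner_commute flip: v_def)
  also have "\<dots> \<le> - \<epsilon> * (\<mu> * (norm v)\<^sup>2)"
    using pos[of v] \<open>0 < \<epsilon>\<close> by simp
  also have "\<dots> = - (\<mu> / \<epsilon>) * (norm b)\<^sup>2"
    using \<open>0 < \<epsilon>\<close> by (simp add: b power2_eq_square field_simps flip: v_def)
  finally have "b \<bullet> q \<le> - (\<mu> / \<epsilon>) * (norm b)\<^sup>2" .
  moreover have "- (b \<bullet> e) \<le> r * norm b"
  proof -
    have "- (b \<bullet> e) \<le> norm b * norm e"
      using norm_cauchy_schwarz[of "- b" e] by simp
    also have "\<dots> \<le> norm b * r" using e by (rule mult_left_mono) simp
    finally show ?thesis by (simp add: mult.commute)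
  qed
  ultimately show ?thesis by (simp add: inner_diff_right)
qed

lemma lyapunov_function_rate:
  assumes W: "lyapunov_function f h W \<alpha> \<beta> \<gamma> \<zeta>" and W': "(W has_derivative W') (at (x, u))"
  shows "W' (f (x, u), b) \<le> - \<gamma> * (norm (x - h u))\<^sup>2 + \<zeta> * norm (x - h u) * norm b"
proof -
  have "b \<bullet> gradient (\<lambda>v. W (x, v)) u \<le> norm b * norm (gradient (\<lambda>v. W (x, v)) u)"
    by (rule norm_cauchy_schwarz)
  also have "\<dots> \<le> norm b * (\<zeta> * norm (x - h u))"
    using W unfolding lyapunov_function_def by (intro mult_left_mono) auto
  finally have "b \<bullet> gradient (\<lambda>v. W (x, v)) u \<le> \<zeta> * norm (x - h u) * norm b"
    by (simp add: mult_ac)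
  moreover have "f (x, u) \<bullet> gradient (\<lambda>y. W (y, u)) x \<le> - \<gamma> * (norm (x - h u))\<^sup>2"
    using W unfolding lyapunov_function_def by (simp add: inner_commute)
  ultimately show ?thesis unfolding partial_gradients[OF W'] by linarith
qed

text \<open>The right-hand side is a multiple of the lower bound on the composite Lyapunov function, with
  \<open>\<eta>\<close> the coefficient of the squared distance to the steady state. It controls
  \<open>x - h us\<close> through \<open>x - h u\<close> and the Lipschitz map \<open>h\<close>.\<close>

lemma dist_steady_state_bound:
  assumes h: "l-lipschitz_on UNIV h" and pos: "0 < \<mu>" "0 < \<eta>"
  shows "(norm ((x, u) - (h us, us)))\<^sup>2
    \<le> (2 * (2 * l\<^sup>2 + 1) / \<mu> + 2 / \<eta>) * (\<mu> / 2 * (norm (u - us))\<^sup>2 + \<eta> * (norm (x - h u))\<^sup>2)"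
proof -
  define a w where "a = norm (u - us)" and "w = norm (x - h u)"
  have "norm (x - h us) \<le> w + l * a"
    using norm_triangle_ineq[of "x - h u" "h u - h us"] lipschitz_onD[OF h, of u us]
    by (simp add: a_def w_def dist_norm)
  then have "(norm (x - h us))\<^sup>2 \<le> (w + l * a)\<^sup>2" by (rule power_mono) simp
  also have "\<dots> \<le> 2 * w\<^sup>2 + 2 * l\<^sup>2 * a\<^sup>2"
    using zero_le_power2[of "w - l * a"] by (simp add: power2_eq_square algebra_simps)
  finally have "(norm ((x, u) - (h us, us)))\<^sup>2 \<le> 2 * w\<^sup>2 + (2 * l\<^sup>2 + 1) * a\<^sup>2"
    by (simp add: norm_Pair a_def algebra_simps)
  also have "\<dots> = 2 / \<eta> * (\<eta> * w\<^sup>2) + 2 * (2 * l\<^sup>2 + 1) / \<mu> * (\<mu> / 2 * a\<^sup>2)"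
    using pos by simp
  also have "\<dots> \<le> (2 * (2 * l\<^sup>2 + 1) / \<mu> + 2 / \<eta>) * (\<eta> * w\<^sup>2)
      + (2 * (2 * l\<^sup>2 + 1) / \<mu> + 2 / \<eta>) * (\<mu> / 2 * a\<^sup>2)"
    using pos by (intro add_mono mult_right_mono) auto
  finally show ?thesis by (simp add: a_def w_def algebra_simps)
qed

theorem mainTheorem2:
  fixes f :: "(real^'n) \<times> (real^'p) \<Rightarrow> real^'n"
    and h :: "real^'p \<Rightarrow> real^'n"
    and \<Phi> W :: "(real^'n) \<times> (real^'p) \<Rightarrow> real"
    and lx lu l L \<alpha> \<beta> \<gamma> \<zeta> \<mu> \<epsilon> :: real
  assumes plant: "plant_assumption f h lx lu l"
    and \<Phi>_C1: "continuously_differentiable \<Phi>"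
    and \<Phi>_grad: "locally_lipschitz (gradient \<Phi>)"
    and L_pos: "L > 0"
    and L_bound: "\<And>x x' u. norm (H_transpose h u (gradient \<Phi> (x', u) - gradient \<Phi> (x, u)))
                    \<le> L * norm (x' - x)"
    and W: "lyapunov_function f h W \<alpha> \<beta> \<gamma> \<zeta>"
    and level: "compact_level_sets (reduced_cost \<Phi> h)"
    and \<mu>_pos: "\<mu> > 0"
    and convex: "strongly_convex \<mu> (reduced_cost \<Phi> h)"
    and C2: "twice_continuously_differentiable (reduced_cost \<Phi> h)"
    and \<epsilon>_pos: "\<epsilon> > 0"
    and Q_lip: "locally_lipschitz (newton_gain \<epsilon> \<Phi> h)"
    and \<epsilon>_small: "\<epsilon> < \<gamma> * \<mu> / (\<zeta> * L)"
  shows "\<exists>xs us.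
           (\<forall>z. is_arg_min \<Phi> (\<lambda>(x, u). x = h u) z \<longleftrightarrow> z = (xs, us)) \<and>
           asymptotically_stable (closed_loop f h \<Phi> (newton_gain \<epsilon> \<Phi> h)) (xs, us) \<and>
           forward_complete (closed_loop f h \<Phi> (newton_gain \<epsilon> \<Phi> h)) \<and>
           (\<forall>z. solution_on (closed_loop f h \<Phi> (newton_gain \<epsilon> \<Phi> h)) {0..} z \<longrightarrow>
                (z \<longlongrightarrow> (xs, us)) at_top)"
proof -
  let ?\<phi> = "reduced_cost \<Phi> h"
  let ?F = "closed_loop f h \<Phi> (newton_gain \<epsilon> \<Phi> h)"
  \<comment> \<open>this weight of \<open>W\<close> gives both cross terms in the decrease estimate the same
    coefficient \<open>L\<close>, which allows the largest range of \<open>\<epsilon>\<close>\<close>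
  define \<delta> where "\<delta> = L / \<zeta>"
  have W_pos: "0 < \<alpha>" "0 < \<gamma>" "0 < \<zeta>" and W_diff: "\<And>z. W differentiable (at z)"
    and W_bounds: "\<And>x u. \<alpha> * (norm (x - h u))\<^sup>2 \<le> W (x, u)"
      "\<And>x u. W (x, u) \<le> \<beta> * (norm (x - h u))\<^sup>2"
    using W unfolding lyapunov_function_def by auto
  have \<delta>: "0 < \<delta>" "\<delta> * \<zeta> = L" using L_pos W_pos by (simp_all add: \<delta>_def)
  have f: "continuously_differentiable f" and h: "continuously_differentiable h"
    and h_lip: "l-lipschitz_on UNIV h" and f_eq: "\<And>u. f (h u, u) = 0"
    using plant unfolding plant_assumption_def by auto
  have \<phi>_diff: "?\<phi> differentiable (at u)" for u
    using C2 continuously_differentiable_imp_differentiable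
    unfolding twice_continuously_differentiable_def by blast
  have \<phi>_grad: "gradient ?\<phi> u = H_transpose h u (gradient \<Phi> (h u, u))" for u
    by (intro gradient_reduced_cost continuously_differentiable_imp_differentiable \<Phi>_C1 h)
  have hess: "(gradient ?\<phi> has_derivative (*v) (hessian ?\<phi> u)) (at u)" for u
    using C2 continuously_differentiable_imp_differentiable
    unfolding twice_continuously_differentiable_def hessian_def jacobian_works[symmetric] by blast
  have hess_pos: "\<mu> * (norm v)\<^sup>2 \<le> (hessian ?\<phi> u *v v) \<bullet> v" for u v
    by (rule strongly_monotone_derivative[OF strongly_convex_gradient_monotone[OF convex] hess])
  obtain us where us: "gradient ?\<phi> us = 0" "\<And>u. ?\<phi> us + \<mu> / 2 * (norm (u - us))\<^sup>2 \<le> ?\<phi> u"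
    using strongly_convex_minimizer[OF level \<mu>_pos convex \<phi>_diff] by blast
  let ?zs = "(h us, us)"

  have F_eq: "?F (x, u) = (f (x, u),
      - (\<epsilon> *\<^sub>R (matrix_inv (hessian ?\<phi> u) *v H_transpose h u (gradient \<Phi> (x, u)))))" for x u
    by (simp add: closed_loop_def newton_gain_def scaleR_matrix_vector_assoc)
  have F_cont: "continuous_on UNIV ?F"
    by (intro continuous_on_closed_loop locally_lipschitz_imp_continuous
        continuously_differentiable_imp_continuous f h \<Phi>_grad Q_lip)
  have equilibrium: "?F ?zs = 0"
    using us(1) by (simp add: F_eq f_eq zero_prod_def flip: \<phi>_grad)

  define V where "V z = ?\<phi> (snd z) + \<delta> * W z" for z
  define V' where "V' z d = snd d \<bullet> gradient ?\<phi> (snd z) + \<delta> * frechet_derivative W (at z) d" for z d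
  have V: "(V has_derivative V' z) (at z)" for z
  proof -
    have "((\<lambda>z. ?\<phi> (snd z)) has_derivative (\<lambda>d. snd d \<bullet> gradient ?\<phi> (snd z))) (at z)"
      by (rule has_derivative_compose[OF has_derivative_snd[OF has_derivative_ident]
            has_derivative_gradient[OF \<phi>_diff]])
    moreover have "(W has_derivative frechet_derivative W (at z)) (at z)"
      using W_diff frechet_derivative_works by blast
    ultimately show ?thesis
      unfolding V_def[abs_def] V'_def[abs_def]
      by (intro has_derivative_add has_derivative_mult_right)
  qed

  define D where "D z = \<mu> / \<epsilon> * (norm (snd (?F z)))\<^sup>2
      - 2 * L * norm (fst z - h (snd z)) * norm (snd (?F z))
      + \<delta> * \<gamma> * (norm (fst z - h (snd z)))\<^sup>2" for z
  have dec: "V' z (?F z) \<le> - D z" for z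
  proof -
    obtain x u where z: "z = (x, u)" by (cases z)
    define w b where "w = norm (x - h u)" and "b = snd (?F (x, u))"
    let ?q = "H_transpose h u (gradient \<Phi> (x, u))"
    have F: "?F (x, u) = (f (x, u), b)" by (simp add: b_def F_eq)
    have "norm (?q - gradient ?\<phi> u) \<le> L * w"
      using L_bound[of u x "h u"] by (simp add: \<phi>_grad w_def flip: H_transpose_diff)
    from newton_step_decrease[OF \<mu>_pos \<epsilon>_pos hess_pos this, of b u ?q]
    have "b \<bullet> gradient ?\<phi> u \<le> - (\<mu> / \<epsilon>) * (norm b)\<^sup>2 + L * w * norm b"
      by (simp add: b_def F_eq)
    moreover have "\<delta> * frechet_derivative W (at (x, u)) (f (x, u), b)
        \<le> \<delta> * (- \<gamma> * w\<^sup>2 + \<zeta> * w * norm b)"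
      using lyapunov_function_rate[OF W, of "frechet_derivative W (at (x, u))" x u b] \<delta>(1)
        W_diff frechet_derivative_works
      unfolding w_def by (intro mult_left_mono) auto
    moreover have "\<delta> * (- \<gamma> * w\<^sup>2 + \<zeta> * w * norm b) = - \<delta> * \<gamma> * w\<^sup>2 + \<delta> * \<zeta> * w * norm b"
      by (simp add: algebra_simps)
    ultimately show ?thesis
      unfolding z V'_def D_def F fst_conv snd_conv w_def[symmetric] \<delta>(2) by linarith
  qed
  \<comment> \<open>negativity of the discriminant; the only place where the bound on \<open>\<epsilon>\<close> is used\<close>
  have gap: "L\<^sup>2 < \<mu> / \<epsilon> * (\<delta> * \<gamma>)"
  proof -
    have "\<epsilon> * (\<zeta> * L) < \<gamma> * \<mu>"
      using \<epsilon>_small L_pos W_pos by (simp add: pos_less_divide_eq)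
    then have "L * (\<epsilon> * (\<zeta> * L)) < L * (\<gamma> * \<mu>)" using L_pos by simp
    then show ?thesis using W_pos \<epsilon>_pos by (simp add: \<delta>_def field_simps power2_eq_square)
  qed
  have D_pos: "0 < D z" if "z \<noteq> ?zs" for z
  proof -
    obtain x u where z: "z = (x, u)" by (cases z)
    have "norm (snd (?F z)) \<noteq> 0 \<or> norm (x - h u) \<noteq> 0"
    proof (rule ccontr)
      assume "\<not> ?thesis"
      then have x: "x = h u" and "snd (?F z) = 0" by auto
      then have "matrix_inv (hessian ?\<phi> u) *v gradient ?\<phi> u = 0"
        using \<epsilon>_pos by (simp add: z F_eq \<phi>_grad)
      then have "gradient ?\<phi> u = 0"
        using matrix_inv_right_if_pos_def[OF \<mu>_pos hess_pos, of u "gradient ?\<phi> u"] by simp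
      then have "\<mu> * (norm (u - us))\<^sup>2 \<le> 0"
        using strongly_convex_gradient_monotone[OF convex, of u us] us(1) by simp
      then have "u = us" using \<mu>_pos by (simp add: mult_le_0_iff)
      then show False using that x z by simp
    qed
    then show ?thesis
      unfolding D_def using quadratic_form_positive[OF _ gap] \<mu>_pos \<epsilon>_pos by (simp add: z)
  qed
  have D_zs: "0 \<le> D ?zs" by (simp add: D_def equilibrium)
  have D_cont: "continuous_on UNIV D"
  proof -
    have "continuous_on UNIV (\<lambda>z::(real^'n) \<times> (real^'p). h (snd z))"
      by (rule continuous_on_compose2[OF continuously_differentiable_imp_continuous[OF h, of UNIV]])
        (auto intro!: continuous_intros)
    then show ?thesis
      unfolding D_def[abs_def] by (intro continuous_intros F_cont)
  qed

  \<comment> \<open>coercivity with this constant holds since \<open>W\<close> vanishes at the equilibrium and \<open>us\<close> minimizes the reduced cost\<close>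
  define C where "C = 2 * (2 * l\<^sup>2 + 1) / \<mu> + 2 / (\<delta> * \<alpha>)"
  have C_pos: "0 < C"
    unfolding C_def using \<mu>_pos \<delta> W_pos by (intro add_pos_pos divide_pos_pos) (auto intro: add_nonneg_pos)
  have coercive: "(norm (z - ?zs))\<^sup>2 \<le> C * (V z - V ?zs)" for z
  proof -
    obtain x u where z: "z = (x, u)" by (cases z)
    have "\<delta> * (\<alpha> * (norm (x - h u))\<^sup>2) \<le> \<delta> * W (x, u)"
      using W_bounds(1) \<delta>(1) by simp
    moreover have "W ?zs = 0" using W_bounds[of "h us" us] by simp
    ultimately have "\<mu> / 2 * (norm (u - us))\<^sup>2 + \<delta> * \<alpha> * (norm (x - h u))\<^sup>2 \<le> V z - V ?zs"
      using us(2)[of u] by (simp add: V_def z)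
    then have "C * (\<mu> / 2 * (norm (u - us))\<^sup>2 + \<delta> * \<alpha> * (norm (x - h u))\<^sup>2) \<le> C * (V z - V ?zs)"
      using C_pos by simp
    moreover have "(norm (z - ?zs))\<^sup>2
        \<le> C * (\<mu> / 2 * (norm (u - us))\<^sup>2 + \<delta> * \<alpha> * (norm (x - h u))\<^sup>2)"
      using dist_steady_state_bound[OF h_lip \<mu>_pos, of "\<delta> * \<alpha>" x u us] \<delta>(1) W_pos(1)
      unfolding C_def z by simp
    ultimately show ?thesis by linarith
  qed

  have "is_arg_min \<Phi> (\<lambda>(x, u). x = h u) z \<longleftrightarrow> z = ?zs" for z
  proof -
    have strict: "?\<phi> us < ?\<phi> u" if "u \<noteq> us" for u
    proof -
      have "0 < \<mu> / 2 * (norm (u - us))\<^sup>2" using that \<mu>_pos by simp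
      then show ?thesis using us(2)[of u] by linarith
    qed
    have min: "?\<phi> us \<le> ?\<phi> u" for u using strict[of u] by (cases "u = us") auto
    show ?thesis
    proof
      assume "is_arg_min \<Phi> (\<lambda>(x, u). x = h u) z"
      then have z: "z = (h (snd z), snd z)" and "\<not> \<Phi> ?zs < \<Phi> z"
        unfolding is_arg_min_def by auto
      then have "\<not> ?\<phi> us < ?\<phi> (snd z)" by (metis reduced_cost_def)
      then show "z = ?zs" using strict z by metis
    next
      assume "z = ?zs"
      then show "is_arg_min \<Phi> (\<lambda>(x, u). x = h u) z"
        using min unfolding is_arg_min_def reduced_cost_def by (auto simp: not_less)
    qed
  qed
  moreover note
    global_asymptotic_stability[OF V D_cont D_pos D_zs dec C_pos coercive equilibrium]
  moreover have "forward_complete ?F"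
  proof (rule forward_complete_lyapunov[OF F_cont V])
    show "V' z (?F z) \<le> 0" for z
      using dec[of z] D_pos[of z] D_zs by (cases "z = ?zs") auto
    show "bounded {z. V z \<le> c}" for c by (rule coercive_bounded_sublevel[OF C_pos coercive])
  qed
  ultimately show ?thesis by blast
qed

end
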